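(* Let $f\ge1$ be an integer, and let $y_k(a,q;x)$ $(k\ge1)$ and $y_\infty(a,q;x)$ be the generating functions of generalized Schröder paths under the line $y=\frac xf$ defined in the context. (1) The generating functions $\{y_k(a,q;x)\}_{k\ge1}$ satisfy, and are determined by, the $q$-difference equations $$y_1(a,q;x)=q^fx\cdot y_{f+1}(a,q;x)+a^2q^{f-1}x\cdot y_f(a,q;x)+1,$$ $$y_k(a,q;x)=y_1(a,q;q^{2(k-1)}x)\cdot y_{k-1}(a,q;x),\qquad k>1,$$ with the initial value $y_1(a,q;0)=1$. (2) The generating function $y_\infty(a,q;x)$ satisfies, and is determined by, the $q$-difference equation $$\frac{q^fx}{y_\infty(a,q;q^{2(f+1)}x)}+\frac{a^2q^{f-1}x}{y_\infty(a,q;q^{2f}x)}-\frac{1}{y_\infty(a,q;q^2x)}+\frac{1}{y_\infty(a,q;x)}=0$$ with the initial value $y_\infty(a,q;0)=1$.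
   Context: $\mathbb{N}=\{0,1,2,\dots\}$. For $i,j,l\in\mathbb{N}$ and $k\in\mathbb{Z}_{\ge1}$, $n_{i,j,l;k}$ is the number of lattice paths from $(0,0)$ to $(fl+k-1,l)$ with right steps $(1,0)$, up steps $(0,1)$ and exactly $\frac i2$ diagonal steps $(1,1)$, continued by infinitely many right steps after $(fl+k-1,l)$, that never go above the line $y=\frac xf$ and such that the area enclosed by the path, the line $y=\frac xf$ and the line $y=l$ is $\frac j2$. The integer $n_{i,j,l;\infty}$ is the number of all (infinite) paths counted by $n_{i,j,l;k}$ for some $k\ge1$ (a path being counted once), i.e. paths of finite height $l$ with $\frac i2$ diagonal steps, enclosing area $\frac j2$, and with no endpoint. Set $$y_k(a,q;x):=\sum_{i,j,l\in\mathbb{N}}n_{i,j,l;k}\,a^iq^jx^l,\qquad y_\infty(a,q;x):=\sum_{i,j,l\in\mathbb{N}}n_{i,j,l;\infty}\,a^iq^jx^l .$$ All series are regarded as formal power series in $x$ with coefficients in $\mathbb{Z}[a][[q]]$; "determined" means uniquely determined among such series. *)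

theory Defs
  imports "HOL-Analysis.Analysis" "HOL-Computational_Algebra.Computational_Algebra"
begin

datatype step = Right | Up | Diag

fun step_vec :: "step \<Rightarrow> real \<times> real" where
  "step_vec Right = (1, 0)"
| "step_vec Up = (0, 1)"
| "step_vec Diag = (1, 1)"

(* A path is an infinite sequence of steps starting at (0,0); vertex p n is reached after n steps. *)
definition vertex :: "(nat \<Rightarrow> step) \<Rightarrow> nat \<Rightarrow> real \<times> real" where
  "vertex p n = (\<Sum>m<n. step_vec (p m))"

definition curve :: "(nat \<Rightarrow> step) \<Rightarrow> (real \<times> real) set" where
  "curve p = (\<Union>n. closed_segment (vertex p n) (vertex p (Suc n)))"

definition below_line :: "nat \<Rightarrow> (nat \<Rightarrow> step) \<Rightarrow> bool" where
  "below_line f p \<longleftrightarrow> (\<forall>(x, y) \<in> curve p. y \<le> x / real f)"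

(* The points under y = x/f and under y = l that lie to the left of (or on) the path.
   The strict y < l omits the horizontal ray at height l in which the path ends; this ray has
   measure zero. *)
definition enclosed_region :: "nat \<Rightarrow> nat \<Rightarrow> (nat \<Rightarrow> step) \<Rightarrow> (real \<times> real) set" where
  "enclosed_region f l p =
     {(x, y). y \<le> x / real f \<and> y < real l \<and> (\<exists>x'\<ge>x. (x', y) \<in> curve p)}"

definition enclosed_area :: "nat \<Rightarrow> nat \<Rightarrow> (nat \<Rightarrow> step) \<Rightarrow> real" where
  "enclosed_area f l p = measure lborel (enclosed_region f l p)"

(* The paths from (0,0) to (f l + k - 1, l), followed by right steps only, that are counted by
   n_{i,j,l;k}. The finite initial part is determined by the infinite path and k, so counting
   infinite paths is the same as counting finite ones. *)
definition schroeder_paths :: "nat \<Rightarrow> nat \<Rightarrow> nat \<Rightarrow> nat \<Rightarrow> nat \<Rightarrow> (nat \<Rightarrow> step) set" where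
  "schroeder_paths f i j l k =
     {p. (\<exists>N. vertex p N = (real f * real l + real k - 1, real l) \<and> (\<forall>n\<ge>N. p n = Right)) \<and>
         below_line f p \<and>
         real (card {n. p n = Diag}) = real i / 2 \<and>
         enclosed_area f l p = real j / 2}"

definition path_count :: "nat \<Rightarrow> nat \<Rightarrow> nat \<Rightarrow> nat \<Rightarrow> nat \<Rightarrow> nat" where
  "path_count f i j l k = card (schroeder_paths f i j l k)"

definition path_count_inf :: "nat \<Rightarrow> nat \<Rightarrow> nat \<Rightarrow> nat \<Rightarrow> nat" where
  "path_count_inf f i j l = card (\<Union>k\<in>{1..}. schroeder_paths f i j l k)"

(* Formal power series in x over Z[a][[q]]: the outer fps variable is x, the inner one is q and
   the polynomial variable is a. *)
type_synonym series = "int poly fps fps"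

definition var_a :: series where "var_a = fps_const (fps_const [:0, 1:])"
definition var_q :: series where "var_q = fps_const fps_X"
definition var_x :: series where "var_x = fps_X"

(* Abs_poly is meaningful here: a path of height l has at most l diagonal steps, so for fixed j
   and l only finitely many counts are nonzero. *)
definition ygf :: "nat \<Rightarrow> nat \<Rightarrow> series" where
  "ygf f k = Abs_fps (\<lambda>l. Abs_fps (\<lambda>j. Abs_poly (\<lambda>i. int (path_count f i j l k))))"

definition ygf_inf :: "nat \<Rightarrow> series" where
  "ygf_inf f = Abs_fps (\<lambda>l. Abs_fps (\<lambda>j. Abs_poly (\<lambda>i. int (path_count_inf f i j l))))"

(* Y(a,q;q^m x) *)
definition qshift :: "nat \<Rightarrow> series \<Rightarrow> series" where
  "qshift m Y = fps_compose Y (var_q ^ m * var_x)"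

(* The multiplicative inverse 1/Y. The library's inverse of power series needs an inverse on
   the coefficients, which Z[a][[q]] lacks; 1/Y is used only for Y with constant term 1 in x. *)
definition recip :: "series \<Rightarrow> series" where
  "recip Y = (THE Z. Y * Z = 1)"

(* Only the members Y k with k \<ge> 1 matter. *)
definition finite_system :: "nat \<Rightarrow> (nat \<Rightarrow> series) \<Rightarrow> bool" where
  "finite_system f Y \<longleftrightarrow>
     Y 1 = var_q ^ f * var_x * Y (f + 1) + var_a ^ 2 * var_q ^ (f - 1) * var_x * Y f + 1 \<and>
     (\<forall>k>1. Y k = qshift (2 * (k - 1)) (Y 1) * Y (k - 1)) \<and>
     fps_nth (Y 1) 0 = 1"

definition infinite_equation :: "nat \<Rightarrow> series \<Rightarrow> bool" where
  "infinite_equation f Y \<longleftrightarrow>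
     var_q ^ f * var_x * recip (qshift (2 * (f + 1)) Y)
       + var_a ^ 2 * var_q ^ (f - 1) * var_x * recip (qshift (2 * f) Y)
       - recip (qshift 2 Y) + recip Y = 0 \<and>
     fps_nth Y 0 = 1"

end

theory Submission
  imports Defs
begin

text \<open>
  Removing the last rise (up or diagonal step) from a path of height \<open>l + 1\<close> leaves a path of
  height \<open>l\<close>. If the rise ends at horizontal distance \<open>v\<close> to the right of the line \<open>y = x / f\<close>, it
  contributes \<open>2 v + f\<close> (up) or \<open>2 v + f - 1\<close> (diagonal) to twice the area, and the path that
  remains has to reach the starting point of the rise, which lies at distance \<open>v + f\<close> or
  \<open>v + f - 1\<close> from the line. A path counted by \<open>y_k\<close> is one whose last rise has \<open>v < k\<close>. Hence
  \<open>y_k = 1 + (\<Sum>v<k. q^(2v) x (q^f y_(v+f+1) + a^2 q^(f-1) y_(v+f)))\<close>,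
  where the dissection (\<open>bij_betw_drop_last_rise\<close>) and the area formula (\<open>enclosed_area_eq\<close>) carry
  the geometry.

  For \<open>k = 1\<close> this is the first equation of the finite system. The whole recursion implies
  \<open>y_(m+n)(x) = y_m(q^(2n) x) y_n(x)\<close> (\<open>linear_recursion_add\<close>): both sides satisfy the same
  recursion in \<open>m\<close>, and the factor \<open>x\<close> in front of the sum reduces every coefficient of the
  difference to lower ones. The case \<open>m = 1\<close> is the second equation.

  A path of area \<open>j / 2\<close> has \<open>v \<le> j\<close> at its last rise, so the coefficient of \<open>q^j\<close> in
  \<open>y_\<infinity>\<close> agrees with that in \<open>y_k\<close> as soon as \<open>k > j\<close>. Letting \<open>m\<close> grow in the product formula
  gives \<open>y_\<infinity>(x) = y_\<infinity>(q^(2n) x) y_n(x)\<close>; dividing the first equation by \<open>y_\<infinity>(x)\<close> and replacing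
  each \<open>y_n(x) / y_\<infinity>(x)\<close> by \<open>1 / y_\<infinity>(q^(2n) x)\<close> yields the equation of part (2).

  Both uniqueness claims are recursions on the coefficients in \<open>x\<close>; in part (2) the equation is
  linear in \<open>1 / y\<close>, and the factor \<open>1 - q^(2l)\<close> of the coefficient at \<open>x^l\<close>, \<open>l \<ge> 1\<close>, is not
  a zero divisor.
\<close>

section \<open>Series in \<open>x\<close> and the substitution \<open>x \<mapsto> q^m x\<close>\<close>

lemma var_q_power_nth: "fps_nth (var_q ^ c * A) l = fps_X ^ c * fps_nth A l"
  by (simp add: var_q_def)

lemma var_a_power_nth: "fps_nth (var_a ^ c * A) l = fps_const [:0, 1:] ^ c * fps_nth A l"
  by (simp add: var_a_def)

lemma var_x_nth: "fps_nth (var_x * A) l = (if l = 0 then 0 else fps_nth A (l - 1))"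
  by (simp add: var_x_def)

lemmas var_nth = var_q_power_nth var_a_power_nth var_x_nth

lemma qshift_nth: "fps_nth (qshift m Y) l = fps_X ^ (m * l) * fps_nth Y l"
proof -
  have pw: "(var_q ^ m * var_x) ^ i = var_q ^ (m * i) * (fps_X ^ i * 1)" for i
    by (simp add: power_mult_distrib power_mult var_x_def)
  have "fps_nth (qshift m Y) l = (\<Sum>i=0..l. fps_nth Y i * (fps_X ^ (m * i) * (if l = i then 1 else 0)))"
    unfolding qshift_def fps_compose_nth pw var_q_power_nth fps_X_power_mult_nth
    by (intro sum.cong) auto
  also have "\<dots> = (\<Sum>i=0..l. if i = l then fps_X ^ (m * l) * fps_nth Y l else 0)"
    by (intro sum.cong) (auto simp: mult.commute)
  finally show ?thesis by simp
qed

lemma qshift_1: "qshift m 1 = 1"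
  by (simp add: fps_eq_iff qshift_nth)

lemma qshift_add: "qshift m (Y + Z) = qshift m Y + qshift m Z"
  by (simp add: fps_eq_iff qshift_nth algebra_simps)

lemma qshift_mult: "qshift m (Y * Z) = qshift m Y * qshift m Z"
proof (rule fps_ext)
  fix l
  have "fps_nth (qshift m (Y * Z)) l
      = (\<Sum>i=0..l. fps_X ^ (m * l) * (fps_nth Y i * fps_nth Z (l - i)))"
    by (simp add: qshift_nth fps_mult_nth sum_distrib_left)
  also have "\<dots> = (\<Sum>i=0..l. fps_nth (qshift m Y) i * fps_nth (qshift m Z) (l - i))"
  proof (rule sum.cong[OF refl])
    fix i assume "i \<in> {0..l}"
    hence "m * l = m * i + m * (l - i)" by (simp flip: distrib_left)
    thus "fps_X ^ (m * l) * (fps_nth Y i * fps_nth Z (l - i))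
        = fps_nth (qshift m Y) i * fps_nth (qshift m Z) (l - i)"
      by (simp add: qshift_nth power_add mult_ac)
  qed
  finally show "fps_nth (qshift m (Y * Z)) l = fps_nth (qshift m Y * qshift m Z) l"
    by (simp add: fps_mult_nth)
qed

lemma qshift_sum: "qshift m (\<Sum>i\<in>I. Y i) = (\<Sum>i\<in>I. qshift m (Y i))"
  by (simp add: fps_eq_iff qshift_nth fps_sum_nth sum_distrib_left)

lemma qshift_var_q: "qshift m (var_q ^ c * Y) = var_q ^ c * qshift m Y"
  by (rule fps_ext) (simp add: qshift_nth var_nth mult.left_commute)

lemma qshift_var_a: "qshift m (var_a ^ c * Y) = var_a ^ c * qshift m Y"
  by (rule fps_ext) (simp add: qshift_nth var_nth mult.left_commute)

lemma qshift_var_x: "qshift m (var_x * Y) = var_q ^ m * (var_x * qshift m Y)"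
proof (rule fps_ext)
  fix l show "fps_nth (qshift m (var_x * Y)) l = fps_nth (var_q ^ m * (var_x * qshift m Y)) l"
    
  proof (cases l)
    case 0
    show ?thesis unfolding 0 qshift_nth var_nth by simp
  next
    case (Suc i)
    thus ?thesis by (simp add: qshift_nth var_nth power_add mult.assoc)
  qed
qed

lemma recip_unique:
  assumes "Y * Z = 1"
  shows "recip Y = Z"
  unfolding recip_def
proof (rule the_equality[of "\<lambda>Z. Y * Z = 1"])
  fix Z' assume "Y * Z' = 1"
  have "Z' = Z' * (Y * Z)" using assms by simp
  also have "\<dots> = (Y * Z') * Z" by (simp add: mult_ac)
  finally show "Z' = Z" using \<open>Y * Z' = 1\<close> by simp
qed fact

lemma mult_recip:
  assumes "fps_nth Y 0 = 1"
  shows "Y * recip Y = 1"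
proof -
  have "Y * fps_right_inverse Y 1 = 1"
    using assms by (intro fps_right_inverse) simp
  thus ?thesis using recip_unique by metis
qed

lemma recip_qshift:
  assumes "fps_nth Y 0 = 1"
  shows "recip (qshift m Y) = qshift m (recip Y)"
  by (rule recip_unique) (simp add: mult_recip[OF assms] qshift_1 flip: qshift_mult)

section \<open>Consequences of the linear recursion\<close>

text \<open>The recursion obtained by conditioning on the last rise: \<open>v\<close> is the horizontal distance from
  the line to the end of that rise, and the two summands belong to an up and a diagonal step.\<close>

definition linear_recursion :: "nat \<Rightarrow> (nat \<Rightarrow> series) \<Rightarrow> bool" where
  "linear_recursion f Y \<longleftrightarrow> (\<forall>k\<ge>1. Y k = 1 + (\<Sum>v<k. var_q ^ (2 * v) *
     (var_x * (var_q ^ f * Y (v + f + 1) + var_a ^ 2 * (var_q ^ (f - 1) * Y (v + f))))))"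

text \<open>The defect \<open>E\<close> of the product formula satisfies the homogeneous version of the recursion. Each
  of its terms carries a factor \<open>x\<close>, so the coefficients of \<open>E\<close> vanish one after the other.\<close>

lemma linear_recursion_add:
  assumes Y: "linear_recursion f Y" and f: "f \<ge> 1" and m: "m \<ge> 1" and n: "n \<ge> 1"
  shows "Y (m + n) = qshift (2 * n) (Y m) * Y n"
proof -
  define T where "T = (\<lambda>A v. var_q ^ (2 * v) *
     (var_x * (var_q ^ f * A (v + f + 1) + var_a ^ 2 * (var_q ^ (f - 1) * A (v + f)))))"
  have rec: "Y k = 1 + (\<Sum>v<k. T Y v)" if "k \<ge> 1" for k
    using Y that unfolding linear_recursion_def T_def by blast
  define E where "E = (\<lambda>k. Y (k + n) - qshift (2 * n) (Y k) * Y n)"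
  have E_rec: "E k = (\<Sum>u<k. var_q ^ (2 * n) * T E u)" if k: "k \<ge> 1" for k
  proof -
    have "(\<Sum>v<n + k. T Y v) = (\<Sum>v<n. T Y v) + (\<Sum>u<k. T Y (n + u))"
      by (induction k) (simp_all add: add.assoc)
    hence "Y (k + n) = 1 + (\<Sum>v<n. T Y v) + (\<Sum>u<k. T Y (n + u))"
      using rec[of "k + n"] n by (simp add: add.commute[of k n] add.assoc)
    also have "\<dots> = Y n + (\<Sum>u<k. T Y (n + u))"
      using rec[OF n] by simp
    finally have 1: "Y (k + n) = Y n + (\<Sum>u<k. T Y (n + u))" .
    have "qshift (2 * n) (T Y u) = var_q ^ (2 * n) * T (\<lambda>i. qshift (2 * n) (Y i)) u" for u
      unfolding T_def qshift_add qshift_var_q qshift_var_x qshift_var_a by (rule mult.left_commute)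
    hence "qshift (2 * n) (Y k)
        = 1 + (\<Sum>u<k. var_q ^ (2 * n) * T (\<lambda>i. qshift (2 * n) (Y i)) u)"
      using rec[OF k] by (simp add: qshift_add qshift_1 qshift_sum)
    moreover have "T (\<lambda>i. qshift (2 * n) (Y i)) u * Y n = T (\<lambda>i. qshift (2 * n) (Y i) * Y n) u" for u
      by (simp add: T_def algebra_simps)
    ultimately have "qshift (2 * n) (Y k) * Y n
        = Y n + (\<Sum>u<k. var_q ^ (2 * n) * T (\<lambda>i. qshift (2 * n) (Y i) * Y n) u)"
      by (simp add: distrib_right sum_distrib_right mult.assoc)
    hence "E k = (\<Sum>u<k. T Y (n + u) - var_q ^ (2 * n) * T (\<lambda>i. qshift (2 * n) (Y i) * Y n) u)"
      by (simp add: E_def 1 sum_subtractf)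
    also have "\<dots> = (\<Sum>u<k. var_q ^ (2 * n) * T E u)"
      by (intro sum.cong refl) (simp add: T_def E_def algebra_simps power_add)
    finally show ?thesis .
  qed
  have "\<forall>k\<ge>1. fps_nth (E k) l = 0" for l
  proof (induction l)
    case 0
    have "fps_nth (T E u) 0 = 0" for u
      unfolding T_def var_nth by simp
    thus ?case by (simp add: E_rec fps_sum_nth var_nth)
  next
    case (Suc l)
    have "fps_nth (T E u) (Suc l) = 0" for u
      using Suc f by (simp add: T_def var_nth)
    thus ?case by (simp add: E_rec fps_sum_nth var_nth)
  qed
  hence "E m = 0" using m by (simp add: fps_eq_iff)
  thus ?thesis by (simp add: E_def)
qed

lemma linear_recursion_imp_finite_system:
  assumes Y: "linear_recursion f Y" and f: "f \<ge> 1"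
  shows "finite_system f Y"
  unfolding finite_system_def
proof (intro conjI allI impI)
  have Y1: "Y 1 = 1 + var_x * (var_q ^ f * Y (f + 1) + var_a ^ 2 * (var_q ^ (f - 1) * Y f))"
    using Y[unfolded linear_recursion_def, rule_format, of 1] by simp
  thus "Y 1 = var_q ^ f * var_x * Y (f + 1) + var_a ^ 2 * var_q ^ (f - 1) * var_x * Y f + 1"
    by (simp add: algebra_simps)
  show "fps_nth (Y 1) 0 = 1"
    unfolding Y1 fps_add_nth var_nth by simp
  fix k :: nat assume "k > 1"
  thus "Y k = qshift (2 * (k - 1)) (Y 1) * Y (k - 1)"
    using linear_recursion_add[OF Y f, of 1 "k - 1"] by simp
qed

text \<open>The second equation writes \<open>Y k\<close> as a product of shifts of \<open>Y 1\<close>, so its coefficients up to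
  \<open>l\<close> depend on those of \<open>Y 1\<close> up to \<open>l\<close> only. The first equation, where \<open>x\<close> is a factor of the
  right-hand side apart from the constant, then gives coefficient \<open>l + 1\<close> of \<open>Y 1\<close>.\<close>

lemma finite_system_unique:
  assumes Y: "finite_system f Y" and Z: "finite_system f Z" and f: "f \<ge> 1" and k: "k \<ge> 1"
  shows "Y k = Z k"
proof -
  have first: "fps_nth (X 1) (Suc l) = fps_X ^ f * fps_nth (X (f + 1)) l
      + fps_const [:0, 1:] ^ 2 * (fps_X ^ (f - 1) * fps_nth (X f) l)"
    if "finite_system f X" for X l
  proof -
    have "X 1 = var_x * (var_q ^ f * X (f + 1) + var_a ^ 2 * (var_q ^ (f - 1) * X f)) + 1"
      using that by (simp add: finite_system_def algebra_simps)
    thus ?thesis by (simp add: var_nth)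
  qed
  have ext: "fps_nth (Y k) l = fps_nth (Z k) l"
    if "\<forall>i\<le>l. fps_nth (Y 1) i = fps_nth (Z 1) i" "k \<ge> 1" for k l
    using that(2,1)
  proof (induction k arbitrary: l rule: dec_induct)
    case (step k)
    have succ: "X (Suc k) = qshift (2 * k) (X 1) * X k" if "finite_system f X" for X
      using that step.hyps unfolding finite_system_def by (metis diff_Suc_1 le_imp_less_Suc One_nat_def)
    have "fps_nth (Y k) i = fps_nth (Z k) i" if "i \<le> l" for i
      using step.IH[of i] step.prems that by simp
    thus ?case
      unfolding succ[OF Y] succ[OF Z] fps_mult_nth qshift_nth
      using step.prems by (intro sum.cong) auto
  qed simp
  have "\<forall>i\<le>l. fps_nth (Y 1) i = fps_nth (Z 1) i" for l
  proof (induction l)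
    case 0
    have "fps_nth (Y 1) 0 = 1" "fps_nth (Z 1) 0 = 1"
      using Y Z unfolding finite_system_def by blast+
    thus ?case by simp
  next
    case (Suc l)
    have "fps_nth (Y 1) (Suc l) = fps_nth (Z 1) (Suc l)"
      unfolding first[OF Y] first[OF Z] using ext[OF Suc] f by simp
    thus ?case using Suc le_Suc_eq by auto
  qed
  thus ?thesis using ext k by (simp add: fps_eq_iff)
qed

text \<open>The equation is linear in the reciprocal series. Its coefficient at \<open>x^(l+1)\<close> determines
  \<open>1 - q^(2(l+1))\<close> times the coefficient of the reciprocal, and this factor cancels because the
  coefficients form an integral domain.\<close>

lemma infinite_equation_unique:
  assumes Y: "infinite_equation f Y" and Z: "infinite_equation f Z"
  shows "Y = Z"
proof -
  have rec: "(1 - fps_X ^ (2 * Suc l)) * fps_nth (recip X) (Suc l)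
      = - (fps_X ^ f * (fps_X ^ (2 * (f + 1) * l) * fps_nth (recip X) l)
        + fps_const [:0, 1:] ^ 2 * (fps_X ^ (f - 1) * (fps_X ^ (2 * f * l) * fps_nth (recip X) l)))"
    if "infinite_equation f X" for X l
  proof -
    have X0: "fps_nth X 0 = 1" using that by (simp add: infinite_equation_def)
    have "recip X - qshift 2 (recip X) = - (var_x * (var_q ^ f * qshift (2 * (f + 1)) (recip X)
        + var_a ^ 2 * (var_q ^ (f - 1) * qshift (2 * f) (recip X))))"
      using that unfolding infinite_equation_def recip_qshift[OF X0]
      by (simp add: algebra_simps add_eq_0_iff)
    from arg_cong[OF this, of "\<lambda>A. fps_nth A (Suc l)"] show ?thesis
      by (simp add: var_nth qshift_nth algebra_simps)
  qed
  have recip0: "fps_nth (recip X) 0 = 1" if "infinite_equation f X" for X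
    using that mult_recip[of X] unfolding infinite_equation_def
    by (metis fps_mult_nth_0 fps_one_nth mult_1)
  have nz: "(1 - fps_X ^ (2 * Suc l) :: int poly fps) \<noteq> 0" for l
  proof
    assume "(1 - fps_X ^ (2 * Suc l) :: int poly fps) = 0"
    hence "fps_nth (1 - fps_X ^ (2 * Suc l) :: int poly fps) 0 = 0" by simp
    thus False by simp
  qed
  have "fps_nth (recip Y) l = fps_nth (recip Z) l" for l
  proof (induction l)
    case (Suc l)
    have "(1 - fps_X ^ (2 * Suc l)) * fps_nth (recip Y) (Suc l)
        = (1 - fps_X ^ (2 * Suc l)) * fps_nth (recip Z) (Suc l)"
      unfolding rec[OF Y] rec[OF Z] Suc ..
    thus ?case using nz[of l] by (simp only: mult_cancel_left) simp
  qed (simp add: recip0 Y Z)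
  hence eq: "recip Y = recip Z" by (simp add: fps_eq_iff)
  have "Y * recip Y = 1" "Z * recip Y = 1"
    using Y Z mult_recip[of Y] mult_recip[of Z] eq by (simp_all add: infinite_equation_def)
  thus ?thesis using recip_unique[of "recip Y"] by (metis mult.commute)
qed

text \<open>The hypothesis \<open>limit\<close> says that \<open>Y k\<close> converges to \<open>Yinf\<close> in the \<open>q\<close>-adic sense, which turns
  \<open>Y (m + n) = qshift (2 * n) (Y m) * Y n\<close> into the same formula with \<open>Yinf\<close> in place of \<open>Y m\<close>
  and \<open>Y (m + n)\<close>. So \<open>Y n\<close> is a quotient of two values of \<open>Yinf\<close>, and the first equation of the
  finite system becomes one for \<open>Yinf\<close> alone.\<close>

lemma infinite_equation_if_limit:
  assumes Y: "linear_recursion f Y" and f: "f \<ge> 1"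
    and limit: "\<And>l j k. k > j \<Longrightarrow> fps_nth (fps_nth Yinf l) j = fps_nth (fps_nth (Y k) l) j"
  shows "infinite_equation f Yinf"
proof -
  have sys: "finite_system f Y" by (rule linear_recursion_imp_finite_system[OF Y f])
  have prod: "Yinf = qshift (2 * n) Yinf * Y n" if n: "n \<ge> 1" for n
  proof (intro fps_ext)
    fix l j
    \<comment> \<open>The coefficient of \<open>q^j\<close> in a product involves only \<open>q^r\<close> with \<open>r \<le> j\<close>, so \<open>Y (j + 1)\<close>
      is close enough to \<open>Yinf\<close>.\<close>
    have lim: "fps_nth (fps_nth (qshift c Yinf) i) r = fps_nth (fps_nth (qshift c (Y (j + 1))) i) r"
      if "r \<le> j" for c i r
      using that limit[of _ "j + 1"] by (simp add: qshift_nth fps_X_power_mult_nth)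
    have "fps_nth (fps_nth Yinf l) j = fps_nth (fps_nth (qshift (2 * n) (Y (j + 1)) * Y n) l) j"
      by (subst linear_recursion_add[OF Y f _ n, of "j + 1", symmetric]) (auto intro: limit)
    also have "\<dots> = fps_nth (fps_nth (qshift (2 * n) Yinf * Y n) l) j"
      unfolding fps_mult_nth fps_sum_nth by (intro sum.cong refl) (simp add: lim)
    finally show "fps_nth (fps_nth Yinf l) j = fps_nth (fps_nth (qshift (2 * n) Yinf * Y n) l) j" .
  qed
  have Y0: "fps_nth (Y k) 0 = 1" if "k \<ge> 1" for k
    unfolding Y[unfolded linear_recursion_def, rule_format, OF that] fps_add_nth fps_sum_nth var_nth
    by simp
  have Yinf0: "fps_nth Yinf 0 = 1"
  proof (rule fps_ext)
    fix j show "fps_nth (fps_nth Yinf 0) j = fps_nth 1 j"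
      using limit[of j "j + 1" 0] Y0[of "j + 1"] by simp
  qed
  define R where "R = recip Yinf"
  have R: "Yinf * R = 1" unfolding R_def by (rule mult_recip[OF Yinf0])
  have shifted: "R * Y n = qshift (2 * n) R" if "n \<ge> 1" for n
  proof -
    have "qshift (2 * n) R = qshift (2 * n) R * (R * Yinf)"
      using R by (simp add: mult.commute)
    also have "\<dots> = R * Y n * qshift (2 * n) (Yinf * R)"
      by (subst prod[OF that]) (simp add: qshift_mult mult_ac)
    finally show ?thesis by (simp add: R qshift_1)
  qed
  have "R * Y 1 = R * (var_q ^ f * var_x * Y (f + 1) + var_a ^ 2 * var_q ^ (f - 1) * var_x * Y f + 1)"
    using sys unfolding finite_system_def by simp
  also have "\<dots> = var_q ^ f * var_x * (R * Y (f + 1)) + var_a ^ 2 * var_q ^ (f - 1) * var_x * (R * Y f) + R"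
    by (simp add: algebra_simps)
  finally have "qshift 2 R = var_q ^ f * var_x * qshift (2 * (f + 1)) R
      + var_a ^ 2 * var_q ^ (f - 1) * var_x * qshift (2 * f) R + R"
    using shifted[of 1] shifted[of "f + 1"] shifted[of f] f by simp
  thus ?thesis
    unfolding infinite_equation_def recip_qshift[OF Yinf0] R_def[symmetric] using Yinf0 by simp
qed

section \<open>Lattice positions along a path\<close>

primrec xpos :: "(nat \<Rightarrow> step) \<Rightarrow> nat \<Rightarrow> nat" where
  "xpos p 0 = 0"
| "xpos p (Suc n) = xpos p n + of_bool (p n \<noteq> Up)"

primrec ypos :: "(nat \<Rightarrow> step) \<Rightarrow> nat \<Rightarrow> nat" where
  "ypos p 0 = 0"
| "ypos p (Suc n) = ypos p n + of_bool (p n \<noteq> Right)"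

definition rises :: "(nat \<Rightarrow> step) \<Rightarrow> nat set" where
  "rises p = {n. p n \<noteq> Right}"

lemma vertex_eq: "vertex p n = (real (xpos p n), real (ypos p n))"
proof (induction n)
  case (Suc n)
  have "vertex p (Suc n) = vertex p n + step_vec (p n)" by (simp add: vertex_def)
  thus ?case using Suc by (cases "p n") simp_all
qed (simp add: vertex_def zero_prod_def)

lemma xpos_mono: "m \<le> n \<Longrightarrow> xpos p m \<le> xpos p n"
  by (rule lift_Suc_mono_le) auto

lemma ypos_mono: "m \<le> n \<Longrightarrow> ypos p m \<le> ypos p n"
  by (rule lift_Suc_mono_le) auto

lemma pos_cong:
  assumes "\<And>m. m < n \<Longrightarrow> p m = q m"
  shows "xpos p n = xpos q n" "ypos p n = ypos q n"
  using assms by (induction n) simp_all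

lemma pos_tail:
  assumes "\<forall>n\<ge>N. p n = Right"
  shows "xpos p (N + i) = xpos p N + i" "ypos p (N + i) = ypos p N"
  using assms by (induction i) simp_all

text \<open>On the final ray of right steps the abscissa is injective, so it tells the time.\<close>

lemma tail_start_unique:
  assumes "\<forall>n\<ge>N. p n = Right" "\<forall>n\<ge>M. p n = Right" "xpos p N = xpos p M"
  shows "N = M"
proof (cases "N \<le> M")
  case True
  then obtain i where "M = N + i" by (auto simp: le_iff_add)
  thus ?thesis using pos_tail(1)[OF assms(1), of i] assms(3) by simp
next
  case False
  then obtain i where "N = M + i" by (metis nat_le_linear le_iff_add)
  thus ?thesis using pos_tail(1)[OF assms(2), of i] assms(3) by simp
qed

lemma ypos_rise_less:
  assumes "n \<in> rises p" "n < m"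
  shows "ypos p n < ypos p m"
  using assms ypos_mono[of "Suc n" m p] by (simp add: rises_def)

text \<open>A step raises the height by at most one, so no level is skipped.\<close>

lemma rise_at_level:
  assumes "m < ypos p N"
  obtains n where "n < N" "n \<in> rises p" "ypos p n = m"
proof -
  have "\<exists>n<N. n \<in> rises p \<and> ypos p n = m"
    using assms
  proof (induction N)
    case (Suc N)
    show ?case
    proof (cases "m < ypos p N")
      case True
      thus ?thesis using Suc.IH less_SucI by blast
    next
      case False
      hence "N \<in> rises p \<and> ypos p N = m"
        using Suc.prems by (cases "p N = Right") (auto simp: rises_def)
      thus ?thesis by blast
    qed
  qed simp
  thus ?thesis using that by blast
qed

lemma tail_imp_finite_rises:
  assumes "\<forall>n\<ge>N. p n = Right"
  shows "finite (rises p)" "rises p \<subseteq> {..<N}"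
proof -
  show "rises p \<subseteq> {..<N}"
  proof
    fix m assume "m \<in> rises p"
    thus "m \<in> {..<N}" using assms by (cases "m < N") (auto simp: rises_def)
  qed
  thus "finite (rises p)" by (rule finite_subset) simp
qed

lemma curve_iff:
  "(x, y) \<in> curve p \<longleftrightarrow> (\<exists>n u. 0 \<le> u \<and> u \<le> 1 \<and>
     x = real (xpos p n) + u * of_bool (p n \<noteq> Up) \<and>
     y = real (ypos p n) + u * of_bool (p n \<noteq> Right))"
proof -
  have "(x, y) \<in> closed_segment (vertex p n) (vertex p (Suc n)) \<longleftrightarrow>
    (\<exists>u. 0 \<le> u \<and> u \<le> 1 \<and>
     x = real (xpos p n) + u * of_bool (p n \<noteq> Up) \<and>
     y = real (ypos p n) + u * of_bool (p n \<noteq> Right))" for n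
    by (auto simp: in_segment vertex_eq algebra_simps)
  thus ?thesis by (simp add: curve_def)
qed

text \<open>The half-plane under the line is convex, so a segment lies in it if its ends do.\<close>

lemma below_line_iff:
  assumes f: "f \<ge> 1"
  shows "below_line f p \<longleftrightarrow> (\<forall>n. f * ypos p n \<le> xpos p n)"
proof
  assume below: "below_line f p"
  show "\<forall>n. f * ypos p n \<le> xpos p n"
  proof
    fix n
    have "(real (xpos p n), real (ypos p n)) \<in> curve p"
      unfolding curve_iff by (intro exI[of _ n] exI[of _ 0]) simp
    hence "real (ypos p n) \<le> real (xpos p n) / real f"
      using below by (auto simp: below_line_def)
    hence "real (f * ypos p n) \<le> real (xpos p n)"
      using f by (simp add: field_simps)
    thus "f * ypos p n \<le> xpos p n" by (simp only: of_nat_le_iff)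
  qed
next
  assume below: "\<forall>n. f * ypos p n \<le> xpos p n"
  have "y \<le> x / real f" if "(x, y) \<in> curve p" for x y
  proof -
    from that obtain n u where u: "0 \<le> u" "u \<le> 1"
      and x: "x = real (xpos p n) + u * of_bool (p n \<noteq> Up)"
      and y: "y = real (ypos p n) + u * of_bool (p n \<noteq> Right)"
      unfolding curve_iff by blast
    have x': "x = (1 - u) * real (xpos p n) + u * real (xpos p (Suc n))"
      and y': "y = (1 - u) * real (ypos p n) + u * real (ypos p (Suc n))"
      by (simp_all add: x y algebra_simps)
    have "real f * real (ypos p k) \<le> real (xpos p k)" for k
      using below[rule_format, of k] by (simp flip: of_nat_mult)
    hence "(1 - u) * (real f * real (ypos p n)) + u * (real f * real (ypos p (Suc n))) \<le> x"
      unfolding x' using u by (intro add_mono mult_left_mono) (simp_all del: xpos.simps ypos.simps)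
    hence "real f * y \<le> x" unfolding y' by (simp add: algebra_simps)
    thus ?thesis using f by (simp add: field_simps)
  qed
  thus "below_line f p" by (auto simp: below_line_def)
qed

section \<open>The enclosed area\<close>

text \<open>The region of height one above \<open>y = b\<close> between the line \<open>x = c y\<close> and the segment that leaves
  \<open>(X, b)\<close> in direction \<open>(d, 1)\<close>. It is half-open in \<open>y\<close> so that the trapezoids of successive rises
  are disjoint and their union is exactly the enclosed region.\<close>

definition trapezoid :: "real \<Rightarrow> real \<Rightarrow> real \<Rightarrow> real \<Rightarrow> (real \<times> real) set" where
  "trapezoid c X b d = {(x, y). b \<le> y \<and> y < b + 1 \<and> c * y \<le> x \<and> x \<le> X + d * (y - b)}"

lemma trapezoid_borel: "trapezoid c X b d \<in> sets (borel :: (real \<times> real) measure)"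
proof -
  have "trapezoid c X b d
      = {z. b \<le> snd z} \<inter> {z. snd z < b + 1} \<inter> {z. c * snd z \<le> fst z} \<inter> {z. fst z \<le> X + d * (snd z - b)}"
    by (auto simp: trapezoid_def)
  also have "\<dots> \<in> sets borel"
    by (intro sets.Int borel_open borel_closed open_Collect_less closed_Collect_le continuous_intros)
  finally show ?thesis .
qed

text \<open>Fubini with horizontal slices: the slice at height \<open>y\<close> is an interval whose length is affine in
  \<open>y\<close>, and the two hypotheses say that this length is nonnegative at both ends of the height range.\<close>

lemma emeasure_trapezoid:
  assumes "c * b \<le> X" "c * (b + 1) \<le> X + d"
  shows "emeasure lborel (trapezoid c X b d) = ennreal (X - c * b + (d - c) / 2)"
proof -
  define g where "g = (\<lambda>y. X + d * (y - b) - c * y)"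
  define G where "G = (\<lambda>y. X * y + d * (y - b)\<^sup>2 / 2 - c * y\<^sup>2 / 2)"
  have g_nonneg: "g y \<ge> 0" if "b \<le> y" "y \<le> b + 1" for y
  proof -
    \<comment> \<open>\<open>g y\<close> interpolates linearly between its values at \<open>b\<close> and \<open>b + 1\<close>.\<close>
    have "(1 - (y - b)) * (X - c * b) + (y - b) * (X + d - c * (b + 1)) \<ge> 0"
      using assms that by (intro add_nonneg_nonneg mult_nonneg_nonneg) auto
    thus ?thesis by (simp add: g_def algebra_simps)
  qed
  have slice: "(\<lambda>x. (x, y)) -` trapezoid c X b d
      = (if b \<le> y \<and> y < b + 1 then {c * y..X + d * (y - b)} else {})" for y
    by (auto simp: trapezoid_def)
  have T: "trapezoid c X b d \<in> sets (lborel \<Otimes>\<^sub>M lborel)"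
    unfolding lborel_prod using trapezoid_borel by simp
  have "emeasure lborel (trapezoid c X b d)
      = (\<integral>\<^sup>+y. emeasure lborel ((\<lambda>x. (x, y)) -` trapezoid c X b d) \<partial>lborel)"
    using lborel_pair.emeasure_pair_measure_alt2[OF T] by (simp only: lborel_prod)
  also have "\<dots> = (\<integral>\<^sup>+y. ennreal (g y) * indicator {b..b + 1} y \<partial>lborel)"
    \<comment> \<open>The slice at the excluded height \<open>b + 1\<close> is empty, hence equality only almost everywhere.\<close>
  proof (rule nn_integral_cong_AE)
    show "AE y in lborel. emeasure lborel ((\<lambda>x. (x, y)) -` trapezoid c X b d)
        = ennreal (g y) * indicator {b..b + 1} y"
      using AE_lborel_singleton[of "b + 1"]
    proof eventually_elim
      case (elim y)
      thus ?case using g_nonneg[of y] by (auto simp: slice g_def split: split_indicator)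
    qed
  qed
  also have "\<dots> = ennreal (G (b + 1) - G b)"
  proof (rule nn_integral_FTC_Icc)
    show "g \<in> borel_measurable borel" unfolding g_def by measurable
    fix y :: real assume "y \<in> {b..b + 1}"
    show "(G has_real_derivative g y) (at y)"
      unfolding G_def g_def by (auto intro!: derivative_eq_intros simp: field_simps)
  qed (use g_nonneg in auto)
  also have "G (b + 1) - G b = X - c * b + (d - c) / 2"
    by (simp add: G_def field_simps power2_eq_square)
  finally show ?thesis .
qed

definition rise_slab :: "nat \<Rightarrow> (nat \<Rightarrow> step) \<Rightarrow> nat \<Rightarrow> (real \<times> real) set" where
  "rise_slab f p n =
     trapezoid (real f) (real (xpos p n)) (real (ypos p n)) (of_bool (p n = Diag))"

text \<open>Neither coordinate decreases along the path. So for \<open>m \<le> y < m + 1\<close> the rightmost point of the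
  path at height \<open>y\<close> lies on the rise that starts at height \<open>m\<close>: earlier steps reach height \<open>m\<close> at
  most and stay to the left of that rise, later ones start at height \<open>m + 1\<close> or above.\<close>

lemma enclosed_region_eq:
  assumes f: "f \<ge> 1" and tail: "\<forall>n\<ge>N. p n = Right" and l: "ypos p N = l"
  shows "enclosed_region f l p = (\<Union>n\<in>rises p. rise_slab f p n)"
proof (intro subset_antisym subsetI)
  fix z assume "z \<in> enclosed_region f l p"
  then obtain x y x' where z: "z = (x, y)" and line: "y \<le> x / real f" and yl: "y < real l"
    and xx': "x \<le> x'" and "(x', y) \<in> curve p"
    by (auto simp: enclosed_region_def)
  then obtain k u where u: "0 \<le> u" "u \<le> 1"
    and x': "x' = real (xpos p k) + u * of_bool (p k \<noteq> Up)"
    and y: "y = real (ypos p k) + u * of_bool (p k \<noteq> Right)"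
    unfolding curve_iff by blast
  have y0: "y \<ge> 0" using u by (simp add: y)
  define m where "m = nat \<lfloor>y\<rfloor>"
  have m: "real m \<le> y" "y < real m + 1" using y0 unfolding m_def by linarith+
  have "m < ypos p N" using m yl l by linarith
  then obtain n where n: "n \<in> rises p" "ypos p n = m" by (rule rise_at_level)
  have xSuc: "x' \<le> real (xpos p (Suc k))" and ySuc: "y \<le> real (ypos p (Suc k))" 
    and yk: "real (ypos p k) \<le> y"
    using u by (simp_all add: x' y)
  have "x' \<le> real (xpos p n) + of_bool (p n = Diag) * (y - real m)"
  proof (cases k n rule: linorder_cases)
    case less
    hence "xpos p (Suc k) \<le> xpos p n" by (intro xpos_mono) simp
    hence "real (xpos p (Suc k)) \<le> real (xpos p n)" by (rule of_nat_mono)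
    moreover have "of_bool (p n = Diag) * (y - real m) \<ge> 0" using m by simp
    ultimately show ?thesis using xSuc by linarith
  next
    case equal
    hence "u = y - real m" using n by (simp add: y rises_def)
    thus ?thesis using n equal by (cases "p n") (simp_all add: x' rises_def)
  next
    case greater
    hence "m < ypos p k" using ypos_rise_less n by blast
    thus ?thesis using m yk by linarith
  qed
  hence "z \<in> rise_slab f p n"
    using m n line f xx' by (simp add: z rise_slab_def trapezoid_def field_simps)
  thus "z \<in> (\<Union>n\<in>rises p. rise_slab f p n)" using n by blast
next
  fix z assume "z \<in> (\<Union>n\<in>rises p. rise_slab f p n)"
  then obtain n x y where n: "n \<in> rises p" and z: "z = (x, y)"
    and y: "real (ypos p n) \<le> y" "y < real (ypos p n) + 1" and line: "real f * y \<le> x"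
    and x: "x \<le> real (xpos p n) + of_bool (p n = Diag) * (y - real (ypos p n))"
    by (auto simp: rise_slab_def trapezoid_def)
  have "n < N" using tail_imp_finite_rises(2)[OF tail] n by blast
  hence "ypos p n < l" using ypos_rise_less n l by blast
  hence yl: "y < real l" using y by linarith
  have "(real (xpos p n) + of_bool (p n = Diag) * (y - real (ypos p n)), y) \<in> curve p"
    unfolding curve_iff using n y
    by (intro exI[of _ n] exI[of _ "y - real (ypos p n)"]) (cases "p n"; simp add: rises_def)
  hence "\<exists>x'\<ge>x. (x', y) \<in> curve p" using x by blast
  moreover have "y \<le> x / real f" using line f by (simp add: field_simps)
  ultimately show "z \<in> enclosed_region f l p"
    using yl by (simp add: z enclosed_region_def)
qed

text \<open>Twice the area of the trapezoids, in terms of the distance between the line and the end of each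
  rise. For a path under the line both natural-number subtractions are exact if \<open>f \<ge> 1\<close>.\<close>

definition doubled_area :: "nat \<Rightarrow> (nat \<Rightarrow> step) \<Rightarrow> nat" where
  "doubled_area f p = (\<Sum>n\<in>rises p.
     2 * (xpos p (Suc n) - f * ypos p (Suc n)) + (f - of_bool (p n = Diag)))"

lemma enclosed_area_eq:
  assumes f: "f \<ge> 1" and below: "\<forall>n. f * ypos p n \<le> xpos p n"
    and tail: "\<forall>n\<ge>N. p n = Right" and l: "ypos p N = l"
  shows "enclosed_area f l p = real (doubled_area f p) / 2"
proof -
  have below': "real f * real (ypos p n) \<le> real (xpos p n)" for n
    using below[rule_format, of n] by (simp flip: of_nat_mult)
  have em: "emeasure lborel (rise_slab f p n) = ennreal (real (xpos p n) - real f * real (ypos p n)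
      + (of_bool (p n = Diag) - real f) / 2)" if "n \<in> rises p" for n
    unfolding rise_slab_def
    using that below'[of n] below'[of "Suc n"]
    by (intro emeasure_trapezoid) (cases "p n"; simp add: rises_def add.commute)+
  have "measure lborel (rise_slab f p n) = real (2 * (xpos p (Suc n) - f * ypos p (Suc n))
      + (f - of_bool (p n = Diag))) / 2" if n: "n \<in> rises p" for n
  proof -
    have "real (xpos p (Suc n) - f * ypos p (Suc n)) = real (xpos p (Suc n)) - real f * real (ypos p (Suc n))"
      using below[rule_format, of "Suc n"] by (simp only: of_nat_diff of_nat_mult)
    moreover have "real (f - of_bool (p n = Diag)) = real f - of_bool (p n = Diag)"
      using f by auto
    ultimately have eq: "real (xpos p n) - real f * real (ypos p n) + (of_bool (p n = Diag) - real f) / 2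
        = real (2 * (xpos p (Suc n) - f * ypos p (Suc n)) + (f - of_bool (p n = Diag))) / 2"
      using n by (cases "p n") (simp_all add: rises_def field_simps)
    show ?thesis unfolding measure_def em[OF n] eq by simp
  qed
  moreover have "measure lborel (\<Union>n\<in>rises p. rise_slab f p n)
      = (\<Sum>n\<in>rises p. measure lborel (rise_slab f p n))"
  proof (rule measure_finite_Union)
    show "finite (rises p)" using tail by (rule tail_imp_finite_rises)
    show "rise_slab f p ` rises p \<subseteq> sets lborel"
      using trapezoid_borel by (auto simp: rise_slab_def)
    show "emeasure lborel (rise_slab f p n) \<noteq> \<infinity>" if "n \<in> rises p" for n
      using em[OF that] by simp
    show "disjoint_family_on (rise_slab f p) (rises p)"
      unfolding disjoint_family_on_def
    proof (intro ballI impI)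
      fix m n assume mn: "m \<in> rises p" "n \<in> rises p" "m \<noteq> n"
      hence "ypos p m < ypos p n \<or> ypos p n < ypos p m"
        using ypos_rise_less[of m p n] ypos_rise_less[of n p m] by linarith
      thus "rise_slab f p m \<inter> rise_slab f p n = {}"
        by (auto simp: rise_slab_def trapezoid_def)
    qed
  qed
  ultimately show ?thesis
    unfolding enclosed_area_def enclosed_region_eq[OF f tail l] doubled_area_def
    by (simp only: of_nat_sum sum_divide_distrib cong: sum.cong)
qed

section \<open>Removing the last rise\<close>

text \<open>The path stays under the line, is at the point \<open>(f l + n, l)\<close> after \<open>N\<close> steps and only steps to
  the right from there; \<open>n\<close> is the distance of that point from the line, which is \<open>k - 1\<close> for the
  paths counted by \<open>y_k\<close>.\<close>

definition path_to :: "nat \<Rightarrow> nat \<Rightarrow> nat \<Rightarrow> nat \<Rightarrow> (nat \<Rightarrow> step) \<Rightarrow> bool" where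
  "path_to f l n N p \<longleftrightarrow> (\<forall>m. f * ypos p m \<le> xpos p m) \<and>
     xpos p N = f * l + n \<and> ypos p N = l \<and> (\<forall>m\<ge>N. p m = Right)"

definition bounded_paths :: "nat \<Rightarrow> nat \<Rightarrow> nat \<Rightarrow> (nat \<Rightarrow> step) set" where
  "bounded_paths f l n = {p. \<exists>N. path_to f l n N p}"

definition diagonals :: "(nat \<Rightarrow> step) \<Rightarrow> nat" where
  "diagonals p = card {n. p n = Diag}"

lemma schroeder_paths_eq:
  assumes f: "f \<ge> 1"
  shows "schroeder_paths f i j l (Suc n)
    = {p \<in> bounded_paths f l n. 2 * diagonals p = i \<and> doubled_area f p = j}"
proof -
  have half: "real a = real b / 2 \<longleftrightarrow> 2 * a = b" "real c / 2 = real b / 2 \<longleftrightarrow> c = b" for a b c :: nat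
    by linarith+
  have ends: "vertex p N = (real f * real l + real (Suc n) - 1, real l)
      \<longleftrightarrow> xpos p N = f * l + n \<and> ypos p N = l" for p N
    unfolding vertex_eq by (simp flip: of_nat_mult of_nat_add)
  have "enclosed_area f l p = real j / 2 \<longleftrightarrow> doubled_area f p = j" if "p \<in> bounded_paths f l n" for p
    using that enclosed_area_eq[OF f] half by (auto simp: bounded_paths_def path_to_def)
  thus ?thesis
    unfolding schroeder_paths_def below_line_iff[OF f] ends half diagonals_def[symmetric]
    by (auto simp: bounded_paths_def path_to_def)
qed

text \<open>Every step increases the sum of the coordinates, so the endpoint is reached after at most
  \<open>f l + n + l\<close> steps, and only these are free.\<close>

lemma finite_bounded_paths: "finite (bounded_paths f l n)"
proof -
  define M where "M = f * l + n + l"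
  have fin: "finite (UNIV :: step set)"
  proof (rule finite_subset)
    show "(UNIV :: step set) \<subseteq> {Right, Up, Diag}" using step.exhaust by auto
  qed simp
  have N_le: "N \<le> xpos p N + ypos p N" for p N
    by (induction N) (auto simp: Suc_le_eq)
  have "bounded_paths f l n \<subseteq> {p. \<forall>m. (m \<in> {..<M} \<longrightarrow> p m \<in> UNIV) \<and> (m \<notin> {..<M} \<longrightarrow> p m = Right)}"
  proof
    fix p assume "p \<in> bounded_paths f l n"
    then obtain N where "xpos p N = f * l + n" "ypos p N = l" "\<forall>m\<ge>N. p m = Right"
      by (auto simp: bounded_paths_def path_to_def)
    thus "p \<in> {p. \<forall>m. (m \<in> {..<M} \<longrightarrow> p m \<in> UNIV) \<and> (m \<notin> {..<M} \<longrightarrow> p m = Right)}"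
      using N_le[of N p] by (auto simp: M_def)
  qed
  thus ?thesis by (rule finite_subset) (intro finite_set_of_finite_funs fin finite_lessThan)
qed

lemma bounded_paths_0: "bounded_paths f 0 n = {\<lambda>_. Right}"
proof (intro subset_antisym subsetI)
  fix p assume "p \<in> bounded_paths f 0 n"
  then obtain N where N: "ypos p N = 0" "\<forall>m\<ge>N. p m = Right"
    by (auto simp: bounded_paths_def path_to_def)
  have "p m = Right" for m
  proof (cases "m < N")
    case True
    thus ?thesis using N(1) ypos_rise_less[of m p N] by (auto simp: rises_def)
  qed (use N in simp)
  thus "p \<in> {\<lambda>_. Right}" by auto
next
  have "xpos (\<lambda>_. Right) m = m" "ypos (\<lambda>_. Right) m = 0" for m
    by (induction m) simp_all
  thus "p \<in> bounded_paths f 0 n" if "p \<in> {\<lambda>_. Right}" for p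
    using that by (auto simp: bounded_paths_def path_to_def)
qed

text \<open>From here on positions are compared by the position lemmas; unfolding \<open>Suc\<close> would hide the
  point after a rise.\<close>

declare xpos.simps(2) [simp del] ypos.simps(2) [simp del]

definition last_rise :: "(nat \<Rightarrow> step) \<Rightarrow> nat" where
  "last_rise p = Max (rises p)"

text \<open>Flattening the last rise into a right step turns it into part of the final ray. The distance of
  the end of the rise from the line and its kind are what is needed to put it back.\<close>

definition drop_last_rise :: "nat \<Rightarrow> (nat \<Rightarrow> step) \<Rightarrow> (nat \<times> bool) \<times> (nat \<Rightarrow> step)" where
  "drop_last_rise f p = (let N = last_rise p in
     ((xpos p (Suc N) - f * ypos p (Suc N), p N = Diag), p(N := Right)))"

lemma last_rise_upd:
  assumes "\<forall>m\<ge>N. r m = Right" "s \<noteq> Right"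
  shows "last_rise (r(N := s)) = N"
  unfolding last_rise_def
proof (rule Max_eqI)
  have "rises (r(N := s)) \<subseteq> {..<Suc N}"
    using assms by (intro tail_imp_finite_rises) auto
  thus "finite (rises (r(N := s)))" "\<And>m. m \<in> rises (r(N := s)) \<Longrightarrow> m \<le> N"
    by (auto intro: finite_subset)
qed (use assms in \<open>simp add: rises_def\<close>)

text \<open>The rise must start at distance \<open>v + f\<close> (up) or \<open>v + f - 1\<close> (diagonal) in order to end at
  distance \<open>v\<close> one level higher, since the line advances by \<open>f\<close> per level.\<close>

lemma add_rise:
  assumes r: "path_to f l (v + f - of_bool (s = Diag)) N r" and s: "s \<noteq> Right" and f: "f \<ge> 1"
    and v: "v \<le> n"
  shows "r(N := s) \<in> bounded_paths f (Suc l) n"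
    and "xpos (r(N := s)) (Suc N) = f * Suc l + v" "ypos (r(N := s)) (Suc N) = Suc l"
proof -
  let ?p = "r(N := s)"
  have below: "\<forall>m. f * ypos r m \<le> xpos r m" and tail: "\<forall>m\<ge>N. r m = Right"
    and x: "xpos r N = f * l + (v + f - of_bool (s = Diag))" and y: "ypos r N = l"
    using r by (simp_all add: path_to_def)
  have before: "xpos ?p m = xpos r m" "ypos ?p m = ypos r m" if "m \<le> N" for m
    using that by (auto intro!: pos_cong)
  show 1: "xpos ?p (Suc N) = f * Suc l + v" and 2: "ypos ?p (Suc N) = Suc l"
    using x y s f before[of N] by (cases s; simp add: xpos.simps(2) ypos.simps(2))+
  have tail': "\<forall>m\<ge>Suc N. ?p m = Right" using tail by simp
  note after = pos_tail[of "Suc N" ?p, OF tail', unfolded 1 2]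
  have "f * ypos ?p m \<le> xpos ?p m" for m
  proof (cases "m \<le> N")
    case False
    then obtain i where "m = Suc N + i" by (metis less_eq_Suc_le not_le le_Suc_ex)
    thus ?thesis using after[of i] by simp
  qed (use below before in simp)
  moreover have "xpos ?p (Suc N + (n - v)) = f * Suc l + n" "ypos ?p (Suc N + (n - v)) = Suc l"
    using after[of "n - v"] v by simp_all
  ultimately have "path_to f (Suc l) n (Suc N + (n - v)) ?p"
    using tail' by (simp add: path_to_def)
  thus "?p \<in> bounded_paths f (Suc l) n" by (auto simp: bounded_paths_def)
qed

lemma remove_rise:
  assumes p: "p \<in> bounded_paths f (Suc l) n" and f: "f \<ge> 1"
  obtains N v r s where "p = r(N := s)" "path_to f l (v + f - of_bool (s = Diag)) N r"
    "s \<noteq> Right" "v \<le> n"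
proof -
  from p obtain N0 where N0: "xpos p N0 = f * Suc l + n" "ypos p N0 = Suc l" "\<forall>m\<ge>N0. p m = Right"
    and below: "\<forall>m. f * ypos p m \<le> xpos p m"
    unfolding bounded_paths_def path_to_def by blast
  have fin: "finite (rises p)" by (rule tail_imp_finite_rises[OF N0(3)])
  have ne: "rises p \<noteq> {}" using rise_at_level[of 0 p N0] N0(2) by auto
  define N where "N = last_rise p"
  have N: "N \<in> rises p" "\<And>m. m \<in> rises p \<Longrightarrow> m \<le> N"
    using Max_in[OF fin ne] Max_ge[OF fin] by (simp_all add: N_def last_rise_def)
  have tail: "\<forall>m\<ge>Suc N. p m = Right" using N(2) by (force simp: rises_def)
  have "N < N0" using tail_imp_finite_rises(2)[OF N0(3)] N(1) by blast
  hence N0_eq: "N0 = Suc N + (N0 - Suc N)" by simp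
  have ySuc: "ypos p (Suc N) = Suc l"
    using pos_tail(2)[OF tail, of "N0 - Suc N"] N0(2) N0_eq by simp
  have xSuc: "xpos p (Suc N) + (N0 - Suc N) = f * Suc l + n"
    using pos_tail(1)[OF tail, of "N0 - Suc N"] N0(1) N0_eq by simp
  define v where "v = xpos p (Suc N) - f * Suc l"
  have v: "xpos p (Suc N) = f * Suc l + v"
    using below[rule_format, of "Suc N"] ySuc by (simp add: v_def)
  have yN: "ypos p N = l" using ySuc N(1) by (simp add: rises_def ypos.simps(2))
  have xN: "xpos p N = f * l + (v + f - of_bool (p N = Diag))"
    using v N(1) f by (cases "p N") (auto simp: rises_def xpos.simps(2))
  let ?r = "p(N := Right)"
  have before: "xpos ?r m = xpos p m" "ypos ?r m = ypos p m" if "m \<le> N" for m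
    using that by (auto intro!: pos_cong)
  have tail_r: "\<forall>m\<ge>N. ?r m = Right" using tail by (simp add: Suc_le_eq)
  have "f * ypos ?r m \<le> xpos ?r m" for m
  proof (cases "m \<le> N")
    case False
    then obtain i where "m = N + i" by (metis nat_le_linear le_Suc_ex)
    thus ?thesis using pos_tail[of N ?r i, OF tail_r] before[of N] below[rule_format, of N] by simp
  qed (use below before in simp)
  hence "path_to f l (v + f - of_bool (p N = Diag)) N ?r"
    using xN yN tail_r before[of N] by (simp add: path_to_def)
  moreover have "p = ?r(N := p N)" by simp
  moreover have "v \<le> n" using v xSuc by simp
  ultimately show ?thesis
    using that[of ?r N "p N" v] N(1) by (simp add: rises_def)
qed

lemma drop_last_rise_upd:
  assumes "path_to f l (v + f - of_bool (s = Diag)) N r" "s \<noteq> Right" "f \<ge> 1"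
  shows "drop_last_rise f (r(N := s)) = ((v, s = Diag), r)"
proof -
  have tail: "\<forall>m\<ge>N. r m = Right" using assms(1) unfolding path_to_def by blast
  hence "r(N := Right) = r" by (simp add: fun_upd_idem_iff)
  thus ?thesis
    using add_rise(2,3)[OF assms le_refl] last_rise_upd[OF tail assms(2)]
    by (simp add: drop_last_rise_def)
qed

text \<open>The point where the removed rise started lies on the final ray of the remaining path and its
  abscissa is known from \<open>v\<close> and the kind of the rise. This fixes the time at which to put it back,
  which gives injectivity.\<close>

lemma bij_betw_drop_last_rise:
  assumes f: "f \<ge> 1"
  shows "bij_betw (drop_last_rise f) (bounded_paths f (Suc l) n)
    (SIGMA (v, d):{..n} \<times> UNIV. bounded_paths f l (v + f - of_bool d))"
  unfolding bij_betw_def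
proof (intro conjI inj_onI subset_antisym subsetI)
  fix p q assume p: "p \<in> bounded_paths f (Suc l) n" and q: "q \<in> bounded_paths f (Suc l) n"
    and eq: "drop_last_rise f p = drop_last_rise f q"
  obtain N v r s where 1: "p = r(N := s)" "path_to f l (v + f - of_bool (s = Diag)) N r" "s \<noteq> Right"
    using remove_rise[OF p f] .
  obtain N' v' r' s' where 2: "q = r'(N' := s')" "path_to f l (v' + f - of_bool (s' = Diag)) N' r'" "s' \<noteq> Right"
    using remove_rise[OF q f] .
  have same: "v = v'" "s = Diag \<longleftrightarrow> s' = Diag" "r = r'"
    using eq drop_last_rise_upd[OF 1(2,3) f] drop_last_rise_upd[OF 2(2,3) f] 1(1) 2(1) by simp_all
  have "N = N'" using 1(2) 2(2) same by (intro tail_start_unique[of N r N']) (simp_all add: path_to_def)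
  moreover have "s = s'" using same 1(3) 2(3) by (cases s; cases s') auto
  ultimately show "p = q" using same 1(1) 2(1) by simp
next
  fix t assume "t \<in> drop_last_rise f ` bounded_paths f (Suc l) n"
  then obtain p where p: "p \<in> bounded_paths f (Suc l) n" and t: "t = drop_last_rise f p" by blast
  obtain N v r s where 1: "p = r(N := s)" "path_to f l (v + f - of_bool (s = Diag)) N r" "s \<noteq> Right" "v \<le> n"
    using remove_rise[OF p f] .
  thus "t \<in> (SIGMA (v, d):{..n} \<times> UNIV. bounded_paths f l (v + f - of_bool d))"
    using drop_last_rise_upd[OF 1(2,3) f] by (auto simp: t bounded_paths_def)
next
  fix t assume "t \<in> (SIGMA (v, d):{..n} \<times> UNIV. bounded_paths f l (v + f - of_bool d))"
  then obtain v d r N where t: "t = ((v, d), r)" "v \<le> n" "path_to f l (v + f - of_bool d) N r"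
    by (auto simp: bounded_paths_def)
  define s where "s = (if d then Diag else Up)"
  have s: "s \<noteq> Right" "(s = Diag) = d" by (simp_all add: s_def)
  note r = t(3)[folded s(2)]
  show "t \<in> drop_last_rise f ` bounded_paths f (Suc l) n"
    using drop_last_rise_upd[OF r s(1) f] add_rise(1)[OF r s(1) f t(2)] by (force simp: t(1) s(2))
qed

section \<open>Generating functions of paths\<close>

text \<open>The exponent of \<open>a\<close> counts half diagonals and that of \<open>q\<close> half units of area, which doubles both
  statistics.\<close>

definition path_weight :: "nat \<Rightarrow> (nat \<Rightarrow> step) \<Rightarrow> int poly fps" where
  "path_weight f p = fps_const [:0, 1:] ^ (2 * diagonals p) * fps_X ^ doubled_area f p"

lemma statistics_add_rise:
  assumes r: "path_to f l (v + f - of_bool (s = Diag)) N r" and s: "s \<noteq> Right" and f: "f \<ge> 1"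
  shows "diagonals (r(N := s)) = diagonals r + of_bool (s = Diag)"
    and "doubled_area f (r(N := s)) = doubled_area f r + (2 * v + (f - of_bool (s = Diag)))"
proof -
  let ?p = "r(N := s)"
  have tail: "\<forall>m\<ge>N. r m = Right" using r unfolding path_to_def by blast
  note sub = tail_imp_finite_rises[OF tail]
  have "{n. r n = Diag} \<subseteq> rises r" by (auto simp: rises_def)
  hence fin: "finite {n. r n = Diag}" using sub(1) by (rule finite_subset)
  have rN: "r N = Right" using tail by simp
  have "{n. ?p n = Diag} = (if s = Diag then insert N {n. r n = Diag} else {n. r n = Diag})"
    using rN by auto
  thus "diagonals ?p = diagonals r + of_bool (s = Diag)"
    using fin rN by (simp add: diagonals_def)
  have "rises ?p = insert N (rises r)" using s rN by (auto simp: rises_def)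
  moreover have "N \<notin> rises r" using rN by (simp add: rises_def)
  moreover have "(\<Sum>n\<in>rises r. 2 * (xpos ?p (Suc n) - f * ypos ?p (Suc n)) + (f - of_bool (?p n = Diag)))
      = doubled_area f r"
    unfolding doubled_area_def
  proof (rule sum.cong[OF refl])
    fix n assume "n \<in> rises r"
    hence "n < N" using sub(2) by auto
    hence "xpos ?p (Suc n) = xpos r (Suc n)" "ypos ?p (Suc n) = ypos r (Suc n)"
      by (auto intro!: pos_cong)
    thus "2 * (xpos ?p (Suc n) - f * ypos ?p (Suc n)) + (f - of_bool (?p n = Diag))
        = 2 * (xpos r (Suc n) - f * ypos r (Suc n)) + (f - of_bool (r n = Diag))"
      using \<open>n < N\<close> by simp
  qed
  ultimately show "doubled_area f ?p = doubled_area f r + (2 * v + (f - of_bool (s = Diag)))"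
    using add_rise(2,3)[OF r s f le_refl] sub(1)
    by (simp add: doubled_area_def[of f ?p])
qed

lemma sum_path_weight_Suc:
  assumes f: "f \<ge> 1"
  shows "(\<Sum>p\<in>bounded_paths f (Suc l) n. path_weight f p)
    = (\<Sum>v\<le>n. fps_X ^ (2 * v) * (fps_X ^ f * (\<Sum>p\<in>bounded_paths f l (v + f). path_weight f p)
        + fps_const [:0, 1:] ^ 2 * (fps_X ^ (f - 1) * (\<Sum>p\<in>bounded_paths f l (v + f - 1). path_weight f p))))"
proof -
  define g where "g = (\<lambda>((v, d), r). fps_const [:0, 1:] ^ (2 * of_bool d) *
    (fps_X ^ (2 * v + (f - of_bool d)) * path_weight f r))"
  have w: "path_weight f p = g (drop_last_rise f p)" if p: "p \<in> bounded_paths f (Suc l) n" for p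
  proof -
    obtain N v r s where 1: "p = r(N := s)" "path_to f l (v + f - of_bool (s = Diag)) N r" "s \<noteq> Right"
      using remove_rise[OF p f] .
    show ?thesis
      using statistics_add_rise[OF 1(2,3) f]
      by (simp add: 1(1) drop_last_rise_upd[OF 1(2,3) f] path_weight_def g_def power_add mult_ac)
  qed
  have "(\<Sum>p\<in>bounded_paths f (Suc l) n. path_weight f p)
      = (\<Sum>t\<in>(SIGMA (v, d):{..n} \<times> UNIV. bounded_paths f l (v + f - of_bool d)). g t)"
    using sum.reindex_bij_betw[OF bij_betw_drop_last_rise[OF f], of g l n] w by simp
  also have "\<dots> = (\<Sum>v\<le>n. \<Sum>d\<in>UNIV. \<Sum>r\<in>bounded_paths f l (v + f - of_bool d). g ((v, d), r))"
  proof -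
    let ?B = "\<lambda>(v, d). bounded_paths f l (v + f - of_bool d)"
    have "sum g (Sigma ({..n} \<times> UNIV) ?B) = (\<Sum>t\<in>{..n} \<times> UNIV. \<Sum>r\<in>?B t. g (t, r))"
      by (subst sum.Sigma) (auto simp: finite_bounded_paths)
    thus ?thesis by (simp add: sum.cartesian_product split_beta)
  qed
  also have "\<dots> = (\<Sum>v\<le>n. fps_X ^ (2 * v) * (fps_X ^ f * (\<Sum>p\<in>bounded_paths f l (v + f). path_weight f p)
        + fps_const [:0, 1:] ^ 2 * (fps_X ^ (f - 1) * (\<Sum>p\<in>bounded_paths f l (v + f - 1). path_weight f p))))"
    by (intro sum.cong refl)
       (simp add: UNIV_bool g_def power_add distrib_left sum_distrib_left mult_ac)
  finally show ?thesis .
qed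

lemma ygf_nth:
  assumes f: "f \<ge> 1"
  shows "fps_nth (ygf f (Suc n)) l = (\<Sum>p\<in>bounded_paths f l n. path_weight f p)"
proof (rule fps_ext)
  fix j
  let ?B = "bounded_paths f l n"
  have pw: "fps_nth (path_weight f p) j = (if doubled_area f p = j then monom 1 (2 * diagonals p) else 0)" for p
    by (simp add: path_weight_def fps_X_power_mult_right_nth monom_altdef)
  have "(\<lambda>i. int (path_count f i j l (Suc n))) = coeff (\<Sum>p\<in>?B. fps_nth (path_weight f p) j)"
  proof
    fix i
    have "coeff (\<Sum>p\<in>?B. fps_nth (path_weight f p) j) i
        = (\<Sum>p\<in>?B. if 2 * diagonals p = i \<and> doubled_area f p = j then 1 else 0)"
      by (auto simp: coeff_sum pw intro!: sum.cong)
    also have "\<dots> = int (path_count f i j l (Suc n))"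
      by (simp add: path_count_def schroeder_paths_eq[OF f] finite_bounded_paths flip: sum.inter_filter)
    finally show "int (path_count f i j l (Suc n)) = coeff (\<Sum>p\<in>?B. fps_nth (path_weight f p) j) i" ..
  qed
  thus "fps_nth (fps_nth (ygf f (Suc n)) l) j = fps_nth (\<Sum>p\<in>?B. path_weight f p) j"
    by (simp add: ygf_def fps_sum_nth coeff_inverse)
qed

text \<open>The end of the last rise at distance \<open>v\<close> contributes at least \<open>2 v\<close> to twice the area \<open>j\<close>, so
  \<open>v \<le> j < k\<close> and the endpoint belonging to \<open>k\<close> lies on the final ray.\<close>

lemma path_count_inf_eq:
  assumes f: "f \<ge> 1" and k: "k > j"
  shows "path_count_inf f i j l = path_count f i j l k"
proof -
  obtain n where n: "k = Suc n" "n \<ge> j" using k by (cases k) auto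
  have sub: "p \<in> bounded_paths f l n" if p: "p \<in> bounded_paths f l c" and j: "doubled_area f p = j" for p c
  proof (cases l)
    case 0
    thus ?thesis using p by (simp add: bounded_paths_0)
  next
    case (Suc l')
    obtain N v r s where 1: "p = r(N := s)" "path_to f l' (v + f - of_bool (s = Diag)) N r" "s \<noteq> Right"
      using remove_rise[OF p[unfolded Suc] f] .
    have "v \<le> n" using statistics_add_rise(2)[OF 1(2,3) f] j n 1(1) by simp
    thus ?thesis using add_rise(1)[OF 1(2,3) f] 1(1) Suc by simp
  qed
  have "(\<Union>k\<in>{1..}. schroeder_paths f i j l k) = schroeder_paths f i j l k"
  proof (intro subset_antisym subsetI)
    fix p assume "p \<in> (\<Union>k\<in>{1..}. schroeder_paths f i j l k)"
    then obtain c where "p \<in> schroeder_paths f i j l (Suc c)"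
      by (auto simp: Suc_le_eq gr0_conv_Suc)
    thus "p \<in> schroeder_paths f i j l k"
      using sub by (auto simp: n(1) schroeder_paths_eq[OF f])
  qed (use n in auto)
  thus ?thesis by (simp add: path_count_inf_def path_count_def)
qed

lemma ygf_inf_nth:
  assumes "f \<ge> 1" "k > j"
  shows "fps_nth (fps_nth (ygf_inf f) l) j = fps_nth (fps_nth (ygf f k) l) j"
  using path_count_inf_eq[OF assms] by (simp add: ygf_inf_def ygf_def)

section \<open>The \<open>q\<close>-difference equations\<close>

lemma linear_recursion_ygf:
  assumes f: "f \<ge> 1"
  shows "linear_recursion f (ygf f)"
  unfolding linear_recursion_def
proof (intro allI impI fps_ext[where 'a = "int poly fps"])
  fix k l :: nat assume "k \<ge> 1"
  then obtain n where k: "k = Suc n" by (cases k) auto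
  have up: "fps_nth (ygf f (v + f + 1)) i = (\<Sum>p\<in>bounded_paths f i (v + f). path_weight f p)" for v i
    using ygf_nth[OF f, of "v + f"] by simp
  have diag: "fps_nth (ygf f (v + f)) i = (\<Sum>p\<in>bounded_paths f i (v + f - 1). path_weight f p)" for v i
    using ygf_nth[OF f, of "v + f - 1"] f by simp
  show "fps_nth (ygf f k) l = fps_nth (1 + (\<Sum>v<k. var_q ^ (2 * v) *
     (var_x * (var_q ^ f * ygf f (v + f + 1) + var_a ^ 2 * (var_q ^ (f - 1) * ygf f (v + f)))))) l"
  proof (cases l)
    case 0
    have "path_weight f (\<lambda>_. Right) = 1"
      by (simp add: path_weight_def diagonals_def doubled_area_def rises_def)
    thus ?thesis
      unfolding 0 k ygf_nth[OF f] bounded_paths_0 fps_add_nth fps_sum_nth var_nth by simp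
  next
    case (Suc i)
    show ?thesis
      unfolding Suc k ygf_nth[OF f] sum_path_weight_Suc[OF f] fps_add_nth fps_sum_nth var_nth
      by (simp add: up[simplified] diag[simplified] lessThan_Suc_atMost)
  qed
qed

theorem proposition2p3:
  fixes f :: nat
  assumes "f \<ge> 1"
  shows "(finite_system f (ygf f) \<and>
          (\<forall>Y. finite_system f Y \<longrightarrow> (\<forall>k\<ge>1. Y k = ygf f k))) \<and>
         (infinite_equation f (ygf_inf f) \<and>
          (\<forall>Y. infinite_equation f Y \<longrightarrow> Y = ygf_inf f))"
proof -
  note rec = linear_recursion_ygf[OF assms]
  have fin: "finite_system f (ygf f)"
    by (rule linear_recursion_imp_finite_system[OF rec assms])
  have inf: "infinite_equation f (ygf_inf f)"
    by (rule infinite_equation_if_limit[OF rec assms]) (rule ygf_inf_nth[OF assms])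
  show ?thesis
    using fin inf finite_system_unique[OF _ fin assms] infinite_equation_unique[OF _ inf] by blast
qed

end
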